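(* Let $(V,\langle\cdot,\cdot\rangle,A)$ be a $3$-dimensional algebraic model. The following two conditions are equivalent: (i) $(V,\langle\cdot,\cdot\rangle,A)$ is Osserman. (ii) $(V,\langle\cdot,\cdot\rangle,A)$ satisfies the Rakić duality principle.
   Context: An algebraic model $(V,\langle\cdot,\cdot\rangle,A)$ of dimension $n$ consists of an $n$-dimensional real vector space $V$, a positive definite inner product $\langle\cdot,\cdot\rangle$ on $V$, and an algebraic curvature tensor $A$, i.e. a $(0,4)$-tensor (multilinear map $V^4\to\mathbb{R}$) satisfying, for all $x,y,z,w\in V$, $$A(x,y,z,w)=-A(y,x,z,w)=A(z,w,x,y),\qquad A(x,y,z,w)+A(y,z,x,w)+A(z,x,y,w)=0.$$ The curvature operator is defined by $\langle A(x,y)z,w\rangle=A(x,y,z,w)$. The Jacobi operator of $x\in V$ is $\mathcal{J}(x)y=A(y,x)x$; it is self-adjoint and $\mathcal{J}(x)x=0$, so it restricts to $x^\perp$. The model is Osserman if the eigenvalues (counted with multiplicity) of $\mathcal{J}(x)$ do not depend on the unit vector $x\in V$. The model satisfies the Rakić duality principle if for all unit vectors $x,y\in V$ and every real number $\lambda$: $\mathcal{J}(x)y=\lambda y$ if and only if $\mathcal{J}(y)x=\lambda x$. *)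

theory Defs
  imports "HOL-Analysis.Analysis"
begin

text \<open>The inner product space \<open>V\<close> is a type of class \<open>euclidean_space\<close>, with
  its inner product \<open>x \<bullet> y\<close>; the dimension of \<open>V\<close> is \<open>DIM('a)\<close>.\<close>

definition multilinear4 :: "('a::real_vector \<Rightarrow> 'a \<Rightarrow> 'a \<Rightarrow> 'a \<Rightarrow> real) \<Rightarrow> bool" where
  "multilinear4 A \<longleftrightarrow>
     (\<forall>y z w. linear (\<lambda>x. A x y z w)) \<and>
     (\<forall>x z w. linear (\<lambda>y. A x y z w)) \<and>
     (\<forall>x y w. linear (\<lambda>z. A x y z w)) \<and>
     (\<forall>x y z. linear (\<lambda>w. A x y z w))"

definition algebraic_curvature_tensor ::
  "('a::real_vector \<Rightarrow> 'a \<Rightarrow> 'a \<Rightarrow> 'a \<Rightarrow> real) \<Rightarrow> bool" where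
  "algebraic_curvature_tensor A \<longleftrightarrow>
     multilinear4 A \<and>
     (\<forall>x y z w. A x y z w = - A y x z w) \<and>
     (\<forall>x y z w. A x y z w = A z w x y) \<and>
     (\<forall>x y z w. A x y z w + A y z x w + A z x y w = 0)"

definition curvature_operator ::
  "('a::euclidean_space \<Rightarrow> 'a \<Rightarrow> 'a \<Rightarrow> 'a \<Rightarrow> real) \<Rightarrow> 'a \<Rightarrow> 'a \<Rightarrow> 'a \<Rightarrow> 'a" where
  "curvature_operator A x y z = (THE v. \<forall>w. v \<bullet> w = A x y z w)"

definition jacobi_operator ::
  "('a::euclidean_space \<Rightarrow> 'a \<Rightarrow> 'a \<Rightarrow> 'a \<Rightarrow> real) \<Rightarrow> 'a \<Rightarrow> 'a \<Rightarrow> 'a" where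
  "jacobi_operator A x y = curvature_operator A y x x"

text \<open>The definite description is always well defined for a multilinear \<open>A\<close>, by Riesz
  representation.\<close>

lemma inner_curvature_operator:
  assumes "multilinear4 A"
  shows "curvature_operator A x y z \<bullet> w = A x y z w"
proof -
  have lin: "linear (A x y z)"
    using assms by (simp add: multilinear4_def)
  define v where "v = adjoint (A x y z) 1"
  have v: "\<forall>w. v \<bullet> w = A x y z w"
    using adjoint_works[OF lin] by (simp add: v_def inner_commute)
  have "curvature_operator A x y z = v"
    unfolding curvature_operator_def
  proof (rule the_equality)
    fix u assume "\<forall>w. u \<bullet> w = A x y z w"
    then show "u = v"
      using v by (metis vector_eq_rdot)
  qed (fact v)
  then show ?thesis
    using v by simp
qed

lemma jacobi_operator_self_adjoint:
  assumes "algebraic_curvature_tensor A"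
  shows "jacobi_operator A x y \<bullet> z = y \<bullet> jacobi_operator A x z"
proof -
  have ml: "multilinear4 A"
    and skew: "\<And>x y z w. A x y z w = - A y x z w"
    and swap: "\<And>x y z w. A x y z w = A z w x y"
    using assms unfolding algebraic_curvature_tensor_def by blast+
  have "A y x x z = A z x x y"
    by (metis skew swap)
  then show ?thesis
    by (simp add: jacobi_operator_def inner_commute[of y] inner_curvature_operator[OF ml])
qed

lemma linear_jacobi_operator:
  assumes "algebraic_curvature_tensor A"
  shows "linear (jacobi_operator A x)"
proof (rule linearI)
  fix y z :: 'a and c :: real
  show "jacobi_operator A x (y + z) = jacobi_operator A x y + jacobi_operator A x z"
    by (rule vector_eq_rdot[THEN iffD1])
      (metis inner_add_left inner_add_right jacobi_operator_self_adjoint[OF assms])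
  show "jacobi_operator A x (c *\<^sub>R y) = c *\<^sub>R jacobi_operator A x y"
    by (rule vector_eq_rdot[THEN iffD1])
      (metis inner_scaleR_left jacobi_operator_self_adjoint[OF assms])
qed

definition eigenvalue_multiplicity :: "('a::euclidean_space \<Rightarrow> 'a) \<Rightarrow> real \<Rightarrow> nat" where
  "eigenvalue_multiplicity f \<mu> = dim {v. f v = \<mu> *\<^sub>R v}"

text \<open>Jacobi operators are self-adjoint, so all their eigenvalues are real and the algebraic and
  geometric multiplicities agree. The eigenvalues with multiplicity are therefore recorded by the
  dimensions of the real eigenspaces; the value is \<open>0\<close> when \<open>\<mu>\<close> is not an eigenvalue.\<close>

definition osserman ::
  "('a::euclidean_space \<Rightarrow> 'a \<Rightarrow> 'a \<Rightarrow> 'a \<Rightarrow> real) \<Rightarrow> bool" where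
  "osserman A \<longleftrightarrow>
     (\<forall>x y. norm x = 1 \<longrightarrow> norm y = 1 \<longrightarrow>
        (\<forall>\<mu>. eigenvalue_multiplicity (jacobi_operator A x) \<mu>
            = eigenvalue_multiplicity (jacobi_operator A y) \<mu>))"

definition rakic_duality ::
  "('a::euclidean_space \<Rightarrow> 'a \<Rightarrow> 'a \<Rightarrow> 'a \<Rightarrow> real) \<Rightarrow> bool" where
  "rakic_duality A \<longleftrightarrow>
     (\<forall>x y \<mu>. norm x = 1 \<longrightarrow> norm y = 1 \<longrightarrow>
        (jacobi_operator A x y = \<mu> *\<^sub>R y \<longleftrightarrow> jacobi_operator A y x = \<mu> *\<^sub>R x))"

end

theory Submission
  imports Defs
begin

text \<open>
  Both conditions say that the model has constant sectional curvature, and this is how the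
  equivalence is proved. Write \<open>J x\<close> for the Jacobi operator, so that for orthonormal \<open>x, y\<close> the
  number \<open>J x y \<bullet> y = J y x \<bullet> x\<close> is the sectional curvature of the plane they span.

  The pivot is the lemma \<open>constant_curvature_if_isotropic\<close>: if in every orthonormal triple
  \<open>x, y, z\<close> the planes \<open>xy\<close> and \<open>xz\<close> have the same curvature, then the curvature is constant.
  Indeed, applying the hypothesis to the rotated pair \<open>y + z, y - z\<close> makes \<open>J x y \<bullet> z\<close>
  vanish too, so \<open>J x\<close> is scalar on the complement of \<open>x\<close>. Curvatures of planes sharing a vector
  therefore agree, and two arbitrary vectors have a common perpendicular.

  Osserman implies isotropy because the trace of \<open>J x\<close> does not depend on \<open>x\<close>: the three
  curvatures of an orthonormal triple add up pairwise to one and the same number, so they are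
  equal. To read off the trace from the dimensions of the eigenspaces, \<open>J x\<close> is diagonalised
  by a rotation of the complement of \<open>x\<close>.

  Duality implies isotropy because it says that for an orthonormal triple the numbers
  \<open>p = J x y \<bullet> z\<close> and \<open>q = J y x \<bullet> z\<close> vanish simultaneously. Under a rotation of the plane \<open>xy\<close>
  the pair \<open>(p, q)\<close> is itself rotated, so it can be brought to \<open>(0, sqrt (p\<^sup>2 + q\<^sup>2))\<close>;
  hence \<open>p = q = 0\<close> always. A half-right-angle rotation of \<open>y, z\<close> turns this into isotropy.
\<close>

section \<open>Orthonormal triples\<close>

definition orthonormal3 :: "'a::euclidean_space \<Rightarrow> 'a \<Rightarrow> 'a \<Rightarrow> bool" where
  "orthonormal3 x y z \<longleftrightarrow> norm x = 1 \<and> norm y = 1 \<and> norm z = 1 \<and>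
     x \<bullet> y = 0 \<and> x \<bullet> z = 0 \<and> y \<bullet> z = 0"

lemma orthonormal3_inner:
  assumes "orthonormal3 x y z"
  shows "x \<bullet> x = 1" "y \<bullet> y = 1" "z \<bullet> z = 1"
    "x \<bullet> y = 0" "y \<bullet> x = 0" "x \<bullet> z = 0" "z \<bullet> x = 0" "y \<bullet> z = 0" "z \<bullet> y = 0"
  using assms by (auto simp: orthonormal3_def norm_eq_1 inner_commute)

lemma orthonormal3I:
  assumes "x \<bullet> x = 1" "y \<bullet> y = 1" "z \<bullet> z = 1" "x \<bullet> y = 0" "x \<bullet> z = 0" "y \<bullet> z = 0"
  shows "orthonormal3 x y z"
  using assms by (auto simp: orthonormal3_def norm_eq_1)

lemma orthonormal3_permute:
  assumes "orthonormal3 x y z"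
  shows "orthonormal3 y x z" "orthonormal3 z x y" "orthonormal3 x z y"
  using assms by (auto simp: orthonormal3_def inner_commute)

lemma orthonormal3_rotate:
  assumes "orthonormal3 x y z" and cs: "c\<^sup>2 + s\<^sup>2 = 1"
  shows "orthonormal3 x (c *\<^sub>R y + s *\<^sub>R z) (c *\<^sub>R z - s *\<^sub>R y)"
  using cs
  by (intro orthonormal3I; simp add: inner_simps orthonormal3_inner[OF assms(1)] power2_eq_square)

lemma exists_unit_orthogonal:
  fixes x y :: "'a::euclidean_space"
  assumes "DIM('a) = 3"
  obtains u where "norm u = 1" "x \<bullet> u = 0" "y \<bullet> u = 0"
proof -
  have "dim {x, y} < DIM('a)"
    using dim_le_card'[of "{x, y}"] card_insert_le_m1[of 2 "{y}" x] assms by auto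
  then obtain w where w: "w \<noteq> 0" "\<And>v. v \<in> span {x, y} \<Longrightarrow> orthogonal w v"
    by (rule orthogonal_to_subspace_exists) blast
  have "orthogonal w x" "orthogonal w y"
    by (auto intro!: w(2) span_base)
  with w(1) show thesis
    by (intro that[of "sgn w"]) (auto simp: norm_sgn sgn_div_norm orthogonal_def inner_commute)
qed

lemma extend_to_orthonormal3:
  fixes x :: "'a::euclidean_space"
  assumes "DIM('a) = 3" "norm x = 1"
  obtains y z where "orthonormal3 x y z"
proof -
  obtain y where y: "norm y = 1" "x \<bullet> y = 0"
    using exists_unit_orthogonal[OF assms(1), of x x] by metis
  obtain z where "norm z = 1" "x \<bullet> z = 0" "y \<bullet> z = 0"
    using exists_unit_orthogonal[OF assms(1), of x y] by metis
  with y assms(2) show thesis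
    by (intro that[of y z]) (auto simp: orthonormal3_def)
qed

lemma orthonormal3_basis:
  fixes x y z :: "'a::euclidean_space"
  assumes "DIM('a) = 3" "orthonormal3 x y z"
  shows "independent {x, y, z}" "span {x, y, z} = UNIV" "distinct [x, y, z]"
proof -
  note i = orthonormal3_inner[OF assms(2)]
  have n0: "0 \<notin> {x, y, z}"
    using i by auto
  have "pairwise orthogonal {x, y, z}"
    using i by (auto simp: pairwise_def orthogonal_def)
  then show ind: "independent {x, y, z}"
    using n0 by (rule pairwise_orthogonal_independent)
  show d: "distinct [x, y, z]"
    using i by auto
  have "card {x, y, z} = DIM('a)"
    using d assms(1) by simp
  then show "span {x, y, z} = UNIV"
    using card_ge_dim_independent[OF subset_UNIV ind] by (simp add: top.extremum_unique)
qed

lemma orthonormal3_eqI: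
  fixes x y z u v :: "'a::euclidean_space"
  assumes "DIM('a) = 3" "orthonormal3 x y z"
    and "u \<bullet> x = v \<bullet> x" "u \<bullet> y = v \<bullet> y" "u \<bullet> z = v \<bullet> z"
  shows "u = v"
proof -
  have "orthogonal (u - v) w" for w
  proof (rule orthogonal_to_span)
    show "w \<in> span {x, y, z}"
      using orthonormal3_basis(2)[OF assms(1,2)] by simp
  qed (use assms(3-) in \<open>auto simp: orthogonal_def inner_diff_left\<close>)
  from this[of "u - v"] show ?thesis
    by (simp add: orthogonal_def)
qed

text \<open>Comparing coordinates, the eigenspace for \<open>\<mu>\<close> is the span of those basis vectors whose
  diagonal entry is \<open>\<mu>\<close>. This converts dimensions of eigenspaces into a list of eigenvalues.\<close>

lemma eigenvalue_multiplicity_diagonal: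
  fixes f :: "'a::euclidean_space \<Rightarrow> 'a"
  assumes dim3: "DIM('a) = 3" and o: "orthonormal3 x y z" and f: "linear f"
    and diag: "f x = a *\<^sub>R x" "f y = b *\<^sub>R y" "f z = c *\<^sub>R z"
  shows "eigenvalue_multiplicity f \<mu> = of_bool (a = \<mu>) + of_bool (b = \<mu>) + of_bool (c = \<mu>)"
proof -
  note i = orthonormal3_inner[OF o]
  note d = orthonormal3_basis(3)[OF dim3 o]
  define B where "B = (if a = \<mu> then {x} else {}) \<union> (if b = \<mu> then {y} else {})
    \<union> (if c = \<mu> then {z} else {})"
  have "{v. f v = \<mu> *\<^sub>R v} = span B"
  proof (intro equalityI subsetI)
    fix v assume "v \<in> span B"
    then show "v \<in> {v. f v = \<mu> *\<^sub>R v}"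
    proof (induction rule: span_induct_alt)
      case base
      show ?case using linear_0[OF f] by simp
    next
      case (step k u v)
      then have "f u = \<mu> *\<^sub>R u"
        using diag by (auto simp: B_def split: if_splits)
      with step show ?case
        by (simp add: linear_add[OF f] linear_scale[OF f] algebra_simps)
    qed
  next
    fix v assume "v \<in> {v. f v = \<mu> *\<^sub>R v}"
    then have fv: "f v = \<mu> *\<^sub>R v" by simp
    have v: "v = (v \<bullet> x) *\<^sub>R x + (v \<bullet> y) *\<^sub>R y + (v \<bullet> z) *\<^sub>R z" (is "v = ?s")
      by (rule orthonormal3_eqI[OF dim3 o]) (simp_all add: inner_simps i)
    have fv': "f v = (v \<bullet> x) *\<^sub>R a *\<^sub>R x + (v \<bullet> y) *\<^sub>R b *\<^sub>R y + (v \<bullet> z) *\<^sub>R c *\<^sub>R z"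
      by (subst v) (simp only: linear_add[OF f] linear_scale[OF f] diag)
    have "f v \<bullet> x = a * (v \<bullet> x)" "f v \<bullet> y = b * (v \<bullet> y)" "f v \<bullet> z = c * (v \<bullet> z)"
      unfolding fv' by (simp_all add: inner_simps i)
    then have co: "a = \<mu> \<or> v \<bullet> x = 0" "b = \<mu> \<or> v \<bullet> y = 0" "c = \<mu> \<or> v \<bullet> z = 0"
      unfolding fv by auto
    have mem: "k *\<^sub>R u \<in> span B" if "u \<in> B \<or> k = 0" for k u
      using that by (auto intro: span_scale span_base span_zero)
    have "(v \<bullet> x) *\<^sub>R x \<in> span B"
      using co(1) by (intro mem) (auto simp: B_def)
    moreover have "(v \<bullet> y) *\<^sub>R y \<in> span B"
      using co(2) by (intro mem) (auto simp: B_def)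
    moreover have "(v \<bullet> z) *\<^sub>R z \<in> span B"
      using co(3) by (intro mem) (auto simp: B_def)
    ultimately show "v \<in> span B"
      by (subst v) (intro span_add)
  qed
  moreover have "dim (span B) = card B"
  proof -
    have "independent B"
      using orthonormal3_basis(1)[OF dim3 o] by (rule independent_mono) (auto simp: B_def)
    then show ?thesis by (simp add: dim_eq_card_independent)
  qed
  moreover have "card B = of_bool (a = \<mu>) + of_bool (b = \<mu>) + of_bool (c = \<mu>)"
    using d by (auto simp: B_def)
  ultimately show ?thesis
    by (simp add: eigenvalue_multiplicity_def)
qed

text \<open>Diagonalisation of a symmetric bilinear form on a plane: a rotation by a right angle
  changes the sign of the off-diagonal entry, so this entry vanishes for some angle in between.\<close>

lemma exists_diagonalising_rotation:
  fixes p q r :: real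
  obtains c s where "c\<^sup>2 + s\<^sup>2 = 1" "c * s * (r - p) + (c\<^sup>2 - s\<^sup>2) * q = 0"
proof -
  define g where "g t = cos t * sin t * (r - p) + ((cos t)\<^sup>2 - (sin t)\<^sup>2) * q" for t
  have cont: "continuous_on {0..pi/2} g"
    unfolding g_def by (intro continuous_intros)
  have ends: "g 0 = q" "g (pi/2) = - q"
    by (simp_all add: g_def)
  have "\<exists>t. g t = 0"
  proof (cases "q \<le> 0")
    case True
    then show ?thesis using IVT'[of g 0 0 "pi/2"] cont ends by auto
  next
    case False
    then show ?thesis using IVT2'[of g "pi/2" 0 0] cont ends by auto
  qed
  then obtain t where "g t = 0" by blast
  then show thesis
    using that[OF sin_cos_squared_add2[of t]] unfolding g_def by blast
qed

section \<open>Jacobi operators and constant curvature\<close>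

text \<open>All sectional curvatures equal \<open>c\<close>, expressed by the Jacobi operators: each is \<open>c\<close> times the
  orthogonal projection onto the complement of its unit vector.\<close>

definition constant_curvature ::
  "('a::euclidean_space \<Rightarrow> 'a \<Rightarrow> 'a \<Rightarrow> 'a \<Rightarrow> real) \<Rightarrow> real \<Rightarrow> bool" where
  "constant_curvature A c \<longleftrightarrow>
     (\<forall>x v. norm x = 1 \<longrightarrow> jacobi_operator A x v = c *\<^sub>R (v - (x \<bullet> v) *\<^sub>R x))"

context
  fixes A :: "'a::euclidean_space \<Rightarrow> 'a \<Rightarrow> 'a \<Rightarrow> 'a \<Rightarrow> real"
  assumes dim3: "DIM('a) = 3" and curv: "algebraic_curvature_tensor A"
begin

abbreviation J :: "'a \<Rightarrow> 'a \<Rightarrow> 'a" where "J \<equiv> jacobi_operator A"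

lemma curvature_multilinear: "multilinear4 A"
  using curv unfolding algebraic_curvature_tensor_def by blast

lemma jacobi_inner: "J x y \<bullet> z = A y x x z"
  by (simp add: jacobi_operator_def inner_curvature_operator[OF curvature_multilinear])

lemma curvature_skew: "A x y z w = - A y x z w"
  using curv unfolding algebraic_curvature_tensor_def by blast

lemma curvature_pair_swap: "A x y z w = A z w x y"
  using curv unfolding algebraic_curvature_tensor_def by blast

lemma curvature_linear:
  "linear (\<lambda>x. A x y z w)" "linear (\<lambda>y. A x y z w)" "linear (\<lambda>z. A x y z w)"
  using curvature_multilinear by (simp_all add: multilinear4_def)

lemma jacobi_self: "J x x = 0"
proof -
  have "J x x \<bullet> w = 0 \<bullet> w" for w
    using curvature_skew[of x x x w] by (simp add: jacobi_inner)
  then show ?thesis by (metis vector_eq_rdot)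
qed

lemma jacobi_inner_self: "J x y \<bullet> x = 0"
  using jacobi_operator_self_adjoint[OF curv, of x y x] by (simp add: jacobi_self)

lemma sectional_symmetric: "J x y \<bullet> y = J y x \<bullet> x"
  unfolding jacobi_inner by (metis curvature_skew curvature_pair_swap minus_minus)

lemma jacobi_bilinear:
  "J x (u + v) = J x u + J x v" "J x (u - v) = J x u - J x v" "J x (k *\<^sub>R u) = k *\<^sub>R J x u"
  using linear_jacobi_operator[OF curv, of x] by (simp_all add: linear_add linear_diff linear_scale)

lemma jacobi_symmetric: "J x v \<bullet> u = J x u \<bullet> v"
  using jacobi_operator_self_adjoint[OF curv, of x v u] by (simp add: inner_commute)

text \<open>For \<open>c\<^sup>2 + s\<^sup>2 = 1\<close> these are the entries of \<open>J x\<close> on the complement of \<open>x\<close> in a rotated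
  basis. Their trace does not depend on the rotation, and the rotation by half a right angle
  exchanges, up to factors, the off-diagonal entry with the difference of the diagonal ones.\<close>

lemma jacobi_rotated:
  fixes c s :: real and x y z :: 'a
  defines "y' \<equiv> c *\<^sub>R y + s *\<^sub>R z" and "z' \<equiv> c *\<^sub>R z - s *\<^sub>R y"
  shows "J x y' \<bullet> y' = c\<^sup>2 * (J x y \<bullet> y) + 2 * c * s * (J x y \<bullet> z) + s\<^sup>2 * (J x z \<bullet> z)"
    and "J x z' \<bullet> z' = s\<^sup>2 * (J x y \<bullet> y) - 2 * c * s * (J x y \<bullet> z) + c\<^sup>2 * (J x z \<bullet> z)"
    and "J x y' \<bullet> z' = c * s * (J x z \<bullet> z - J x y \<bullet> y) + (c\<^sup>2 - s\<^sup>2) * (J x y \<bullet> z)"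
  using jacobi_symmetric[of x z y] unfolding y'_def z'_def
  by (simp_all add: jacobi_bilinear inner_simps power2_eq_square algebra_simps)

lemma half_right_angle: "(sqrt 2 / 2)\<^sup>2 + (sqrt 2 / 2)\<^sup>2 = (1::real)"
  by (simp add: power_divide)

text \<open>Curvature is constant as soon as, in each orthonormal triple, two planes through the same
  vector have the same curvature: rotating by half a right angle shows that \<open>J x\<close> is scalar on the
  complement of \<open>x\<close>, and the scalar is propagated from \<open>x\<close> to any other unit vector through a
  common perpendicular.\<close>

lemma constant_curvature_if_isotropic:
  assumes iso: "\<And>x y z. orthonormal3 x y z \<Longrightarrow> J x y \<bullet> y = J x z \<bullet> z"
  shows "\<exists>c. constant_curvature A c"
proof -
  have scalar: "J x v = (J x y \<bullet> y) *\<^sub>R (v - (x \<bullet> v) *\<^sub>R x)"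
    if xy: "norm x = 1" "norm y = 1" "x \<bullet> y = 0" for x y v
  proof -
    obtain z where "norm z = 1" "x \<bullet> z = 0" "y \<bullet> z = 0"
      using exists_unit_orthogonal[OF dim3, of x y] by metis
    with xy have o: "orthonormal3 x y z"
      by (simp add: orthonormal3_def)
    note i = orthonormal3_inner[OF o]
    have off: "J x y \<bullet> z = 0"
      using iso[OF orthonormal3_rotate[OF o half_right_angle]]
      unfolding jacobi_rotated by (simp add: power_divide)
    have "J x v \<bullet> y = (J x y \<bullet> y) * (v \<bullet> y)" "J x v \<bullet> z = (J x y \<bullet> y) * (v \<bullet> z)"
    proof -
      have "J x y = (J x y \<bullet> y) *\<^sub>R y"
        by (rule orthonormal3_eqI[OF dim3 o]) (simp_all add: i off jacobi_inner_self)
      then show "J x v \<bullet> y = (J x y \<bullet> y) * (v \<bullet> y)"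
        by (metis jacobi_symmetric inner_commute inner_scaleR_left)
      have "J x z = (J x y \<bullet> y) *\<^sub>R z"
        by (rule orthonormal3_eqI[OF dim3 o])
          (simp_all add: i off jacobi_inner_self jacobi_symmetric[of x z y] iso[OF o])
      then show "J x v \<bullet> z = (J x y \<bullet> y) * (v \<bullet> z)"
        by (metis jacobi_symmetric inner_commute inner_scaleR_left)
    qed
    then show ?thesis
      by (intro orthonormal3_eqI[OF dim3 o])
        (simp_all add: i jacobi_inner_self inner_simps inner_commute[of v])
  qed
  have shared: "J x y \<bullet> y = J x y' \<bullet> y'"
    if "norm x = 1" "norm y = 1" "x \<bullet> y = 0" "norm y' = 1" "x \<bullet> y' = 0" for x y y'
    using scalar[of x y y'] that by (simp add: norm_eq_1)
  obtain x\<^sub>0 :: 'a where x0: "norm x\<^sub>0 = 1"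
    using vector_choose_size[of 1] by auto
  obtain y\<^sub>0 where y0: "norm y\<^sub>0 = 1" "x\<^sub>0 \<bullet> y\<^sub>0 = 0"
    using exists_unit_orthogonal[OF dim3, of x\<^sub>0 x\<^sub>0] by metis
  have "J x v = (J x\<^sub>0 y\<^sub>0 \<bullet> y\<^sub>0) *\<^sub>R (v - (x \<bullet> v) *\<^sub>R x)" if x: "norm x = 1" for x v
  proof -
    obtain u where u: "norm u = 1" "x \<bullet> u = 0" "x\<^sub>0 \<bullet> u = 0"
      using exists_unit_orthogonal[OF dim3, of x x\<^sub>0] by metis
    have "J x\<^sub>0 y\<^sub>0 \<bullet> y\<^sub>0 = J u x\<^sub>0 \<bullet> x\<^sub>0"
      using shared[of x\<^sub>0 y\<^sub>0 u] x0 y0 u by (simp add: sectional_symmetric)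
    also have "\<dots> = J x u \<bullet> u"
      using shared[of u x\<^sub>0 x] x x0 u sectional_symmetric[of u x] by (simp add: inner_commute)
    finally show ?thesis
      using scalar[of x u v] x u by simp
  qed
  then show ?thesis
    by (auto simp: constant_curvature_def)
qed

section \<open>The Osserman condition\<close>

text \<open>The sum of the two curvatures is the trace of \<open>J x\<close>, here recovered from
  the eigenvalues of \<open>J x\<close>, the eigenvalue belonging to \<open>x\<close> being \<open>0\<close>.\<close>

lemma trace_eigenvalues:
  assumes o: "orthonormal3 x y z"
  shows "\<exists>a b. J x y \<bullet> y + J x z \<bullet> z = a + b \<and> (\<forall>\<mu>. eigenvalue_multiplicity (J x) \<mu>
    = of_bool (0 = \<mu>) + of_bool (a = \<mu>) + of_bool (b = \<mu>))"
proof -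
  obtain c s where cs: "c\<^sup>2 + s\<^sup>2 = 1"
    and off: "c * s * (J x z \<bullet> z - J x y \<bullet> y) + (c\<^sup>2 - s\<^sup>2) * (J x y \<bullet> z) = 0"
    by (rule exists_diagonalising_rotation)
  define y' z' where "y' = c *\<^sub>R y + s *\<^sub>R z" and "z' = c *\<^sub>R z - s *\<^sub>R y"
  have o': "orthonormal3 x y' z'"
    unfolding y'_def z'_def using o cs by (rule orthonormal3_rotate)
  note i = orthonormal3_inner[OF o']
  have off': "J x y' \<bullet> z' = 0"
    unfolding y'_def z'_def jacobi_rotated(3) by (fact off)
  have "J x y' = (J x y' \<bullet> y') *\<^sub>R y'" "J x z' = (J x z' \<bullet> z') *\<^sub>R z'"
    by (rule orthonormal3_eqI[OF dim3 o'];
        simp add: i off' jacobi_inner_self jacobi_symmetric[of x z' y'])+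
  then have "eigenvalue_multiplicity (J x) \<mu>
      = of_bool (0 = \<mu>) + of_bool (J x y' \<bullet> y' = \<mu>) + of_bool (J x z' \<bullet> z' = \<mu>)" for \<mu>
    by (intro eigenvalue_multiplicity_diagonal[OF dim3 o' linear_jacobi_operator[OF curv]])
      (simp_all add: jacobi_self)
  moreover have "J x y \<bullet> y + J x z \<bullet> z = J x y' \<bullet> y' + J x z' \<bullet> z'"
  proof -
    have "J x y' \<bullet> y' + J x z' \<bullet> z' = (c\<^sup>2 + s\<^sup>2) * (J x y \<bullet> y + J x z \<bullet> z)"
      unfolding y'_def z'_def jacobi_rotated by (simp add: algebra_simps)
    with cs show ?thesis by simp
  qed
  ultimately show ?thesis
    by blast
qed

lemma constant_curvature_if_osserman:
  assumes "osserman A"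
  shows "\<exists>c. constant_curvature A c"
proof (rule constant_curvature_if_isotropic)
  have trace: "J x y \<bullet> y + J x z \<bullet> z = J x' y' \<bullet> y' + J x' z' \<bullet> z'"
    if o: "orthonormal3 x y z" and o': "orthonormal3 x' y' z'" for x y z x' y' z'
  proof -
    obtain a b where ab: "J x y \<bullet> y + J x z \<bullet> z = a + b"
      "\<forall>\<mu>. eigenvalue_multiplicity (J x) \<mu> = of_bool (0 = \<mu>) + of_bool (a = \<mu>) + of_bool (b = \<mu>)"
      using trace_eigenvalues[OF o] by blast
    obtain a' b' where ab': "J x' y' \<bullet> y' + J x' z' \<bullet> z' = a' + b'"
      "\<forall>\<mu>. eigenvalue_multiplicity (J x') \<mu> = of_bool (0 = \<mu>) + of_bool (a' = \<mu>) + of_bool (b' = \<mu>)"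
      using trace_eigenvalues[OF o'] by blast
    have counts: "of_bool (a = \<mu>) + of_bool (b = \<mu>) = (of_bool (a' = \<mu>) + of_bool (b' = \<mu>) :: nat)" for \<mu>
    proof -
      have "eigenvalue_multiplicity (J x) \<mu> = eigenvalue_multiplicity (J x') \<mu>"
        using assms o o' unfolding osserman_def orthonormal3_def by blast
      then show ?thesis
        using spec[OF ab(2), of \<mu>] spec[OF ab'(2), of \<mu>] by simp
    qed
    have "a' = a \<or> b' = a"
      using counts[of a] by (cases "a' = a"; cases "b' = a"; simp)
    moreover have "b' = b" if "a' = a"
      using counts[of b] that by (cases "b' = b") simp_all
    moreover have "a' = b" if "b' = a"
      using counts[of b] that by (cases "a' = b") simp_all
    ultimately have "a + b = a' + b'"
      by auto
    then show ?thesis using ab(1) ab'(1) by simp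
  qed
  fix x y z :: 'a assume o: "orthonormal3 x y z"
  \<comment> \<open>The traces at \<open>y\<close> and \<open>z\<close> share the curvature of the plane \<open>yz\<close>.\<close>
  show "J x y \<bullet> y = J x z \<bullet> z"
    using trace[OF orthonormal3_permute(1)[OF o] orthonormal3_permute(2)[OF o]]
    by (simp add: sectional_symmetric[of x] sectional_symmetric[of y z])
qed

lemma osserman_if_constant_curvature:
  assumes "constant_curvature A c"
  shows "osserman A"
proof -
  have "eigenvalue_multiplicity (J x) \<mu> = of_bool (0 = \<mu>) + of_bool (c = \<mu>) + of_bool (c = \<mu>)"
    if x: "norm x = 1" for x \<mu>
  proof -
    obtain y z where o: "orthonormal3 x y z"
      using extend_to_orthonormal3[OF dim3 x] .
    show ?thesis
      using assms x orthonormal3_inner[OF o]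
      by (intro eigenvalue_multiplicity_diagonal[OF dim3 o linear_jacobi_operator[OF curv]])
        (simp_all add: jacobi_self constant_curvature_def)
  qed
  then show ?thesis
    by (simp add: osserman_def)
qed

section \<open>The duality principle\<close>

text \<open>For an orthonormal triple, \<open>y\<close> is an eigenvector of \<open>J x\<close> exactly when \<open>J x y \<bullet> z = 0\<close>, and
  the eigenvalue is then the curvature of the plane \<open>xy\<close>, which is symmetric in \<open>x\<close> and \<open>y\<close>.\<close>

lemma duality_off_diagonal:
  assumes "rakic_duality A" and o: "orthonormal3 x y z" and "J x y \<bullet> z = 0"
  shows "J y x \<bullet> z = 0"
proof -
  note i = orthonormal3_inner[OF o]
  have "J x y = (J x y \<bullet> y) *\<^sub>R y"
    by (rule orthonormal3_eqI[OF dim3 o]) (simp_all add: i assms(3) jacobi_inner_self)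
  then have "J y x = (J x y \<bullet> y) *\<^sub>R x"
    using assms(1) o by (auto simp: rakic_duality_def orthonormal3_def)
  then show ?thesis by (simp add: i)
qed

text \<open>The tensor depends on its first two arguments only through their oriented plane, so under a
  rotation of \<open>x, y\<close> the pair \<open>(J x y \<bullet> z, J y x \<bullet> z)\<close> changes through the third argument alone,
  that is, as a vector of that plane.\<close>

lemma off_diagonal_rotated:
  fixes c s :: real and x y z :: 'a
  assumes cs: "c\<^sup>2 + s\<^sup>2 = 1"
  defines "x' \<equiv> c *\<^sub>R x + s *\<^sub>R y" and "y' \<equiv> c *\<^sub>R y - s *\<^sub>R x"
  shows "J x' y' \<bullet> z = c * (J x y \<bullet> z) - s * (J y x \<bullet> z)"
    and "J y' x' \<bullet> z = s * (J x y \<bullet> z) + c * (J y x \<bullet> z)"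
proof -
  note lin = curvature_linear[THEN linear_add] curvature_linear[THEN linear_diff]
    curvature_linear[THEN linear_scale]
  have plane: "A y' x' u z = A y x u z" for u
  proof -
    have diag: "A x x u z = 0" "A y y u z = 0"
      using curvature_skew[of x x u z] curvature_skew[of y y u z] by simp_all
    have "A y' x' u z = (c\<^sup>2 + s\<^sup>2) * A y x u z"
      using diag curvature_skew[of x y u z]
      unfolding x'_def y'_def by (simp add: lin power2_eq_square algebra_simps)
    then show ?thesis using cs by simp
  qed
  have plane': "A x' y' u z = A x y u z" for u
    using plane curvature_skew by metis
  show "J x' y' \<bullet> z = c * (J x y \<bullet> z) - s * (J y x \<bullet> z)"
    unfolding jacobi_inner plane unfolding x'_def
    using curvature_skew[of x y y z] by (simp add: lin)
  show "J y' x' \<bullet> z = s * (J x y \<bullet> z) + c * (J y x \<bullet> z)"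
    unfolding jacobi_inner plane' unfolding y'_def
    using curvature_skew[of x y x z] by (simp add: lin)
qed

lemma duality_off_diagonal_zero:
  assumes dual: "rakic_duality A" and o: "orthonormal3 x y z"
  shows "J x y \<bullet> z = 0"
proof (rule ccontr)
  define p q where "p = J x y \<bullet> z" and "q = J y x \<bullet> z"
  assume "J x y \<bullet> z \<noteq> 0"
  then have pos: "p\<^sup>2 + q\<^sup>2 > 0"
    by (simp add: p_def sum_power2_gt_zero_iff)
  \<comment> \<open>The rotation that takes \<open>(p, q)\<close> to the second axis.\<close>
  define r c s where "r = sqrt (p\<^sup>2 + q\<^sup>2)" and "c = q / r" and "s = p / r"
  have r: "r > 0" "r\<^sup>2 = p\<^sup>2 + q\<^sup>2"
    using pos by (simp_all add: r_def)
  have cs: "c\<^sup>2 + s\<^sup>2 = 1"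
  proof -
    have "c\<^sup>2 + s\<^sup>2 = (q\<^sup>2 + p\<^sup>2) / r\<^sup>2"
      unfolding c_def s_def power_divide add_divide_distrib ..
    also have "\<dots> = r\<^sup>2 / r\<^sup>2"
      by (simp only: r(2) add.commute)
    finally show ?thesis using r(1) by simp
  qed
  have "orthonormal3 z (c *\<^sub>R x + s *\<^sub>R y) (c *\<^sub>R y - s *\<^sub>R x)"
    using orthonormal3_permute(2)[OF o] cs by (rule orthonormal3_rotate)
  then have o': "orthonormal3 (c *\<^sub>R x + s *\<^sub>R y) (c *\<^sub>R y - s *\<^sub>R x) z"
    by (auto simp: orthonormal3_def inner_commute)
  have "c * p - s * q = 0"
    by (simp add: c_def s_def)
  then have "s * p + c * q = 0"
    using duality_off_diagonal[OF dual o'] unfolding off_diagonal_rotated[OF cs] p_def q_def by simp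
  then have "p\<^sup>2 + q\<^sup>2 = 0"
    using r by (simp add: c_def s_def power2_eq_square add_divide_distrib[symmetric])
  with pos show False by simp
qed

lemma constant_curvature_if_duality:
  assumes "rakic_duality A"
  shows "\<exists>c. constant_curvature A c"
proof (rule constant_curvature_if_isotropic)
  fix x y z :: 'a assume o: "orthonormal3 x y z"
  have "J x ((sqrt 2 / 2) *\<^sub>R y + (sqrt 2 / 2) *\<^sub>R z)
      \<bullet> ((sqrt 2 / 2) *\<^sub>R z - (sqrt 2 / 2) *\<^sub>R y) = 0"
    using assms orthonormal3_rotate[OF o half_right_angle] by (rule duality_off_diagonal_zero)
  then show "J x y \<bullet> y = J x z \<bullet> z"
    unfolding jacobi_rotated by simp
qed

lemma duality_if_constant_curvature:
  assumes "constant_curvature A c"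
  shows "rakic_duality A"
proof -
  have jac: "J x v = c *\<^sub>R (v - (x \<bullet> v) *\<^sub>R x)" if "norm x = 1" for x v
    using assms that by (simp add: constant_curvature_def)
  have "J y x = \<mu> *\<^sub>R x" if x: "norm x = 1" and y: "norm y = 1" and eq: "J x y = \<mu> *\<^sub>R y"
    for x y :: 'a and \<mu>
  proof -
    define t where "t = x \<bullet> y"
    have i: "x \<bullet> x = 1" "y \<bullet> y = 1" "x \<bullet> y = t" "y \<bullet> x = t"
      using x y by (simp_all add: norm_eq_1 t_def inner_commute)
    have "\<mu> * t = 0"
      using jacobi_inner_self[of x y] by (simp add: eq i)
    moreover have mu: "\<mu> = c * (1 - t\<^sup>2)"
      using arg_cong[OF eq, of "\<lambda>v. v \<bullet> y"]
      by (simp add: jac[OF x] i inner_simps power2_eq_square)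
    ultimately consider "t = 0" | "c = 0" | "t\<^sup>2 = 1"
      by auto
    then show ?thesis
    proof cases
      case 3
      \<comment> \<open>Equality in the Cauchy-Schwarz inequality: \<open>y\<close> is \<open>x\<close> or \<open>- x\<close>.\<close>
      have "(x - t *\<^sub>R y) \<bullet> (x - t *\<^sub>R y) = 0"
        using 3 by (simp add: inner_simps i power2_eq_square)
      then have "x - t *\<^sub>R y = 0" by simp
      then show ?thesis using 3 by (simp add: jac[OF y] i mu)
    qed (simp_all add: jac[OF y] i mu)
  qed
  then show ?thesis
    unfolding rakic_duality_def by blast
qed

end

theorem theorem3:
  fixes A :: "'a::euclidean_space \<Rightarrow> 'a \<Rightarrow> 'a \<Rightarrow> 'a \<Rightarrow> real"
  assumes "DIM('a) = 3"
    and "algebraic_curvature_tensor A"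
  shows "osserman A \<longleftrightarrow> rakic_duality A"
  using constant_curvature_if_osserman[OF assms] osserman_if_constant_curvature[OF assms]
    constant_curvature_if_duality[OF assms] duality_if_constant_curvature[OF assms]
  by blast

end
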